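(* For every integer $n\ge 1$, the matrix ring over dual numbers $M_n(\mathbb{D})$ is not uniquely $\mathrm{NR}$-clean.
   Context: $\mathbb{D}=\{a+b\epsilon \mid a,b\in\mathbb{R},\ \epsilon^2=0\}$ is the ring of dual numbers, and $M_n(\mathbb{D})$ is the ring of $n\times n$ matrices over $\mathbb{D}$. An element $r$ of a ring $R$ (associative with identity) is (von Neumann) regular if $r=rxr$ for some $x\in R$. A ring $R$ is uniquely $\mathrm{NR}$-clean if every $a\in R$ can be written in exactly one way as $a=r+t$ with $r\in R$ regular and $t\in R$ nilpotent. *)

theory Defs
  imports Complex_Main "HOL-Algebra.Ring" "Jordan_Normal_Form.Matrix"
begin

(* Dual a b stands for a + b * eps with eps * eps = 0. *)
datatype dual = Dual (re_part: real) (eps_part: real)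

instantiation dual :: comm_ring_1
begin

definition "0 = Dual 0 0"
definition "1 = Dual 1 0"
definition "x + y = Dual (re_part x + re_part y) (eps_part x + eps_part y)"
definition "x - y = Dual (re_part x - re_part y) (eps_part x - eps_part y)"
definition "- x = Dual (- re_part x) (- eps_part x)"
definition "x * y = Dual (re_part x * re_part y) (re_part x * eps_part y + eps_part x * re_part y)"

instance
  by standard
    (simp_all add: zero_dual_def one_dual_def plus_dual_def minus_dual_def uminus_dual_def
      times_dual_def algebra_simps)

end

definition dual_eps :: dual where
  "dual_eps = Dual 0 1"

lemma dual_eps_square: "dual_eps * dual_eps = 0"
  by (simp add: dual_eps_def times_dual_def zero_dual_def)

lemma Dual_eq: "Dual a b = Dual a 0 + Dual b 0 * dual_eps"
  by (simp add: dual_eps_def times_dual_def plus_dual_def)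

definition regular_elem :: "('a, 'm) ring_scheme \<Rightarrow> 'a \<Rightarrow> bool" where
  "regular_elem R r \<longleftrightarrow>
     r \<in> carrier R \<and> (\<exists>x \<in> carrier R. r = r \<otimes>\<^bsub>R\<^esub> x \<otimes>\<^bsub>R\<^esub> r)"

definition nilpotent_elem :: "('a, 'm) ring_scheme \<Rightarrow> 'a \<Rightarrow> bool" where
  "nilpotent_elem R t \<longleftrightarrow>
     t \<in> carrier R \<and> (\<exists>k::nat. k \<ge> 1 \<and> t [^]\<^bsub>R\<^esub> k = \<zero>\<^bsub>R\<^esub>)"

(* A property of rings: R is meant to satisfy the locale ring.  This is not a conjunct,
   so that the negation really denies the decomposition property. *)
definition uniquely_NR_clean :: "('a, 'm) ring_scheme \<Rightarrow> bool" where
  "uniquely_NR_clean R \<longleftrightarrow>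
     (\<forall>a \<in> carrier R. \<exists>!(r, t). regular_elem R r \<and> nilpotent_elem R t \<and> a = r \<oplus>\<^bsub>R\<^esub> t)"

abbreviation dual_matrix_ring :: "nat \<Rightarrow> dual mat ring" where
  "dual_matrix_ring n \<equiv> ring_mat TYPE(dual) n ()"

lemma ring_dual_matrix_ring: "ring (dual_matrix_ring n)"
  by (rule ring_mat)

end

(* In any ring a nonzero t with t * t = 0 gives 1 - t invertible with inverse 1 + t, so
   1 = 1 + 0 = (1 - t) + t are two distinct decompositions of 1.
   In the matrix ring take t = eps * I. *)
theory Submission
  imports Defs
begin

text \<open>It is uniqueness, not existence, that fails: a nonzero square-zero \<open>t\<close> can
  be moved out of the regular part of \<open>\<one>\<close> into the nilpotent part, since
  \<open>\<one> \<ominus> t\<close> is still a unit. The matrices enter only through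
  \<open>dual_eps\<close> times the identity, which supplies such a \<open>t\<close>.\<close>

lemma (in ring) square_zero_not_uniquely_NR_clean:
  assumes t: "t \<in> carrier R" and nz: "t \<noteq> \<zero>" and sq: "t \<otimes> t = \<zero>"
  shows "\<not> uniquely_NR_clean R"
proof
  assume "uniquely_NR_clean R"
  then have "\<exists>!(r, s). regular_elem R r \<and> nilpotent_elem R s \<and> \<one> = r \<oplus> s"
    unfolding uniquely_NR_clean_def by blast
  moreover have "regular_elem R \<one>"
    unfolding regular_elem_def by (auto intro: bexI[of _ \<one>])
  moreover have "nilpotent_elem R \<zero>"
    unfolding nilpotent_elem_def by (auto intro: exI[of _ 1])
  moreover have "regular_elem R (\<one> \<ominus> t)"
  proof -
    have "(\<one> \<ominus> t) \<otimes> (\<one> \<oplus> t) = \<one>"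
      using t sq by (simp add: minus_eq l_distr r_distr l_minus a_assoc l_neg)
    \<comment> \<open>A right inverse suffices as inner inverse: multiply the previous equation by
      \<open>\<one> \<ominus> t\<close> on the right.\<close>
    then have "\<one> \<ominus> t = (\<one> \<ominus> t) \<otimes> (\<one> \<oplus> t) \<otimes> (\<one> \<ominus> t)"
      using t by simp
    then show ?thesis
      using t unfolding regular_elem_def by (auto intro: bexI[of _ "\<one> \<oplus> t"])
  qed
  moreover have "nilpotent_elem R t"
    unfolding nilpotent_elem_def using t sq
    by (auto simp: numeral_2_eq_2 intro: exI[of _ 2])
  moreover have "\<one> = \<one> \<oplus> \<zero>" "\<one> = (\<one> \<ominus> t) \<oplus> t"
    using t by (simp_all add: minus_eq a_assoc l_neg)
  \<comment> \<open>The pairs \<open>(\<one>, \<zero>)\<close> and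
    \<open>(\<one> \<ominus> t, t)\<close> already differ in the second component, because
    \<open>t\<close> is nonzero.\<close>
  ultimately show False
    using nz by blast
qed

theorem proposition4p11:
  fixes n :: nat
  assumes "n \<ge> 1"
  shows "\<not> uniquely_NR_clean (dual_matrix_ring n)"
proof (rule ring.square_zero_not_uniquely_NR_clean[OF ring_dual_matrix_ring])
  let ?t = "dual_eps \<cdot>\<^sub>m 1\<^sub>m n"
  show "?t \<in> carrier (dual_matrix_ring n)"
    by (simp add: ring_mat_simps)
  \<comment> \<open>The bound \<open>n \<ge> 1\<close> provides a corner entry, here
    \<open>dual_eps\<close>; over size 0 the matrix would be zero.\<close>
  have "?t $$ (0, 0) \<noteq> 0"
    using assms by (simp add: dual_eps_def zero_dual_def one_dual_def times_dual_def)
  then show "?t \<noteq> \<zero>\<^bsub>dual_matrix_ring n\<^esub>"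
    using assms index_zero_mat(1)[of 0 n 0 n] unfolding ring_mat_simps by force
  have "?t * ?t = (dual_eps * dual_eps) \<cdot>\<^sub>m 1\<^sub>m n"
    by (intro eq_matI) (auto simp: mult_smult_assoc_mat[of _ n n _ n])
  also have "\<dots> = 0\<^sub>m n n"
    by (intro eq_matI) (auto simp: dual_eps_square)
  finally show "?t \<otimes>\<^bsub>dual_matrix_ring n\<^esub> ?t = \<zero>\<^bsub>dual_matrix_ring n\<^esub>"
    by (simp add: ring_mat_simps)
qed

end
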